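(* Let $I\subseteq\mathbb{R}$ be an interval with interior $I^\circ$, let $a,b\in I^\circ$ with $0<a<b$, and let $f:I\to\mathbb{R}$ be differentiable on $I^\circ$. Let $g:[a,b]\to[0,\infty)$ be a continuous probability density function, i.e. $\int_a^b g(x)\,dx=1$, that is symmetric to $\frac{a+b}{2}$, and suppose that for $\lambda\in\mathbb{R}$ the $\lambda$-moment $E_\lambda(X)=\int_a^b x^\lambda g(x)\,dx$ is finite. Let $h:[0,1]\to[0,\infty)$ be a function with $h\not\equiv0$. If $|f'|$ is $h$-convex on $[a,b]$, then $$\left|\frac{f(a)+f(b)}{2}\int_a^b g(x)\,dx-\int_a^b f(x)g(x)\,dx\right|\leq(b-a)\big(|f'(a)|+|f'(b)|\big)\int_a^{\frac{a+b}{2}}\int_0^{\frac12}g(x)\big[h(t)+h(1-t)\big]\,dt\,dx$$ $$=\frac{b-a}{2}\big(|f'(a)|+|f'(b)|\big)\int_0^{\frac12}\big[h(t)+h(1-t)\big]\,dt.$$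
   Context: A function $g:[a,b]\to\mathbb{R}$ is symmetric to $\frac{a+b}{2}$ if $g(x)=g(a+b-x)$ for all $x\in[a,b]$. Here $X$ is a random variable with density $g$. Let $h:[0,1]\to[0,\infty)$ with $h\not\equiv 0$. A nonnegative function $\varphi:J\to[0,\infty)$ on an interval $J$ is $h$-convex if for all $x,y\in J$ and all $\lambda\in[0,1]$, $\varphi(\lambda x+(1-\lambda)y)\le h(\lambda)\varphi(x)+h(1-\lambda)\varphi(y)$. *)

theory Defs
  imports "HOL-Analysis.Analysis"
begin

definition symmetric_to_midpoint :: "real \<Rightarrow> real \<Rightarrow> (real \<Rightarrow> real) \<Rightarrow> bool" where
  "symmetric_to_midpoint a b g \<longleftrightarrow> (\<forall>x\<in>{a..b}. g x = g (a + b - x))"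

definition h_convex_on :: "(real \<Rightarrow> real) \<Rightarrow> real set \<Rightarrow> (real \<Rightarrow> real) \<Rightarrow> bool" where
  "h_convex_on h J \<phi> \<longleftrightarrow>
     is_interval J \<and> (\<forall>x\<in>J. 0 \<le> \<phi> x) \<and>
     (\<forall>x\<in>J. \<forall>y\<in>J. \<forall>l\<in>{0..1}.
        \<phi> (l * x + (1 - l) * y) \<le> h l * \<phi> x + h (1 - l) * \<phi> y)"

text \<open>
  Integrals of the nonnegative integrands whose convergence is not automatic are
  taken in the extended nonnegative reals.  For the moments, "finite" is then a
  genuine condition.  For the integrals of h, no measurability or integrability of h
  has to be assumed: a divergent integral is infinite (not 0, as it would be for
  the real-valued integral), and for a nonmeasurable integrand the library's
  integral is the lower integral.
\<close>

definition moment :: "real \<Rightarrow> real \<Rightarrow> (real \<Rightarrow> real) \<Rightarrow> real \<Rightarrow> ennreal" where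
  "moment a b g l = (\<integral>\<^sup>+x\<in>{a..b}. ennreal (x powr l * g x) \<partial>lebesgue)"

end

theory Submission
  imports Defs
begin

text \<open>
  For every single point x of [a, b] the deviation of f(x) from the endpoint average is at most half
  the total variation of f:
  |(f(a) + f(b)) / 2 - f(x)| \<le> (|f(x) - f(a)| + |f(b) - f(x)|) / 2 \<le> (\<integral> |f'|) / 2.
  Averaging against the probability density g keeps this bound.  Parametrise [a, b] by
  (1 - t) a + t b with t in [0, 1] and fold the integral of |f'| at t = 1/2.  The folded integrand
  consists of the values of |f'| at two mirrored points, whose weights on the endpoints are t, 1 - t
  and 1 - t, t; adding the two instances of h-convexity therefore bounds it by
  (|f'(a)| + |f'(b)|) (h(t) + h(1 - t)).  This gives the single-integral bound
  (lemma \<open>endpoint_average_deviation\<close> for each point, lemma \<open>deviation_of_average_le\<close> for the average).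

  The double integral has a product integrand, so it is the integral of h(t) + h(1 - t) times the
  mass of g on the left half, and that mass is 1/2 by symmetry (lemma \<open>half_mass_of_symmetric\<close>).

  Regularity enters in two places.  The function h(t) + h(1 - t) may be nonmeasurable; its integral is
  then a lower integral, for which additivity fails; homogeneity survives
  (lemma \<open>nn_integral_cmult_nonmeasurable\<close>) and suffices, because only the measurable side |f'| of
  the estimate is ever split into sums.  Also, f' need not be integrable: its absolute integral is
  kept in the extended nonnegative reals, where the infinite case is trivial, while in the finite case
  the gauge integral, which integrates every derivative, supplies the fundamental theorem.
\<close>

section \<open>Homogeneity of the lower integral\<close>

lemma cmult_nn_integral_le:
  "c * (\<integral>\<^sup>+x. u x \<partial>M) \<le> (\<integral>\<^sup>+x. c * u x \<partial>M)"
  unfolding nn_integral_def SUP_mult_left_ennreal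
proof (rule SUP_mono)
  fix s assume s: "s \<in> {s. simple_function M s \<and> s \<le> u}"
  then have "c * integral\<^sup>S M s = (\<integral>\<^sup>Sx. c * s x \<partial>M)"
    by simp
  with s show "\<exists>s'\<in>{s. simple_function M s \<and> s \<le> (\<lambda>x. c * u x)}. c * integral\<^sup>S M s \<le> integral\<^sup>S M s'"
    by (intro bexI[of _ "\<lambda>x. c * s x"]) (auto simp: le_fun_def intro: mult_left_mono)
qed

text \<open>
  The reverse inequality is the previous one for the scalar inverse of c, applied to c u; this is why
  c must be finite, whereas the integral itself may be infinite.
\<close>
lemma nn_integral_cmult_nonmeasurable:
  assumes "c < \<infinity>"
  shows "(\<integral>\<^sup>+x. c * u x \<partial>M) = c * (\<integral>\<^sup>+x. u x \<partial>M)"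
proof (cases "c = 0")
  case False
  with assms have inv: "c * inverse c = 1" "inverse c * c = 1"
    by (auto simp: ennreal_divide_self divide_ennreal_def[symmetric] mult.commute[of "inverse c"] less_top)
  have "(\<integral>\<^sup>+x. c * u x \<partial>M) = c * (inverse c * (\<integral>\<^sup>+x. c * u x \<partial>M))"
    by (simp add: mult.assoc[symmetric] inv)
  also have "\<dots> \<le> c * (\<integral>\<^sup>+x. inverse c * (c * u x) \<partial>M)"
    by (intro mult_left_mono cmult_nn_integral_le) simp
  also have "\<dots> = c * (\<integral>\<^sup>+x. u x \<partial>M)"
    by (simp add: mult.assoc[symmetric] inv)
  finally show ?thesis
    by (intro antisym cmult_nn_integral_le)
qed simp

section \<open>Derivatives and the endpoint average\<close>

text \<open>
  A derivative is gauge integrable, and gauge integrable functions are Lebesgue measurable.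
\<close>
lemma derivative_measurable_on_interval:
  fixes p p' :: "real \<Rightarrow> real"
  assumes "u \<le> v"
    and "\<And>t. t \<in> {u..v} \<Longrightarrow> (p has_real_derivative p' t) (at t within {u..v})"
  shows "(\<lambda>t. indicator {u..v} t * p' t) \<in> borel_measurable lebesgue"
proof -
  have "(p' has_integral p v - p u) {u..v}"
    using assms by (intro fundamental_theorem_of_calculus)
      (auto simp: has_real_derivative_iff_has_vector_derivative)
  from has_integral_implies_lebesgue_measurable[OF this]
  show ?thesis by simp
qed

text \<open>
  If |p'| has finite integral then the gauge integral of p' in the fundamental theorem of calculus is
  a Lebesgue integral, which the integral of the absolute value bounds.
\<close>
lemma increment_le_nn_integral_derivative:
  fixes p p' :: "real \<Rightarrow> real"
  assumes "u \<le> v"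
    and der: "\<And>t. t \<in> {u..v} \<Longrightarrow> (p has_real_derivative p' t) (at t within {u..v})"
  shows "ennreal \<bar>p v - p u\<bar> \<le> (\<integral>\<^sup>+t\<in>{u..v}. ennreal \<bar>p' t\<bar> \<partial>lebesgue)"
proof (cases "(\<integral>\<^sup>+t\<in>{u..v}. ennreal \<bar>p' t\<bar> \<partial>lebesgue) = \<infinity>")
  case False
  let ?q = "\<lambda>t. indicator {u..v} t * p' t"
  have norm_q: "(\<integral>\<^sup>+t. ennreal (norm (?q t)) \<partial>lebesgue) = (\<integral>\<^sup>+t\<in>{u..v}. ennreal \<bar>p' t\<bar> \<partial>lebesgue)"
    by (intro nn_integral_cong) (auto simp: indicator_def)
  have "integrable lebesgue ?q"
    using derivative_measurable_on_interval[OF assms] False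
    by (simp add: integrable_iff_bounded norm_q less_top del: real_norm_def)
  then have abs_int: "p' absolutely_integrable_on {u..v}"
    by (simp add: set_integrable_def)
  have "(p' has_integral p v - p u) {u..v}"
    using assms by (intro fundamental_theorem_of_calculus)
      (auto simp: has_real_derivative_iff_has_vector_derivative)
  then have "p v - p u = (LINT t|lebesgue. ?q t)"
    using set_lebesgue_integral_eq_integral(2)[OF abs_int]
    by (simp add: set_lebesgue_integral_def integral_unique)
  then show ?thesis
    using integral_norm_bound_ennreal[OF \<open>integrable lebesgue ?q\<close>] norm_q by simp
qed simp

lemma has_derivative_reflected:
  fixes p p' :: "real \<Rightarrow> real"
  assumes der: "\<And>t. t \<in> {0..1} \<Longrightarrow> (p has_real_derivative p' t) (at t within {0..1})"
    and t: "t \<in> {u..v}" and uv: "0 \<le> u" "v \<le> 1"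
  shows "((\<lambda>t. p (1 - t)) has_real_derivative - p' (1 - t)) (at t within {u..v})"
proof -
  have "(p has_real_derivative p' (1 - t)) (at (1 - t) within (\<lambda>t. 1 - t) ` {u..v})"
    using t uv by (intro DERIV_subset[OF der]) auto
  moreover have "((\<lambda>t. 1 - t) has_real_derivative - 1) (at t within {u..v})"
    by (auto intro!: derivative_eq_intros)
  ultimately show ?thesis
    using DERIV_image_chain[of p "p' (1 - t)" "\<lambda>t. 1 - t" t "{u..v}" "- 1"] by (simp add: o_def)
qed

text \<open>
  Twice the deviation is at most the length of the path of values p(0), p(s), p(1/2), p(1).  The first
  two increments are paid for by p' on [0, 1/2], the last one by the reflected derivative on the same
  interval, so that the integral over [0, 1] appears already folded and no change of variables in an
  integral of p' is needed.
\<close>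
lemma endpoint_average_deviation_left_half:
  fixes p p' :: "real \<Rightarrow> real"
  assumes der: "\<And>t. t \<in> {0..1} \<Longrightarrow> (p has_real_derivative p' t) (at t within {0..1})"
    and s: "s \<in> {0..1/2}"
  shows "ennreal (2 * \<bar>(p 0 + p 1) / 2 - p s\<bar>)
           \<le> (\<integral>\<^sup>+t\<in>{0..1/2}. ennreal (\<bar>p' t\<bar> + \<bar>p' (1 - t)\<bar>) \<partial>lebesgue)"
proof -
  define q where "q t = p (1 - t)" for t
  have dp: "(p has_real_derivative p' t) (at t within {u..v})"
    if "t \<in> {u..v}" "0 \<le> u" "v \<le> 1/2" for t u v
    using that by (intro DERIV_subset[OF der]) auto
  have dq: "(q has_real_derivative - p' (1 - t)) (at t within {0..1/2})"
    if "t \<in> {0..1/2}" for t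
    using has_derivative_reflected[OF der, of t 0 "1/2"] that by (simp add: q_def[abs_def])
  have split_at_s: "(\<integral>\<^sup>+t\<in>{0..s}. ennreal \<bar>p' t\<bar> \<partial>lebesgue) + (\<integral>\<^sup>+t\<in>{s..1/2}. ennreal \<bar>p' t\<bar> \<partial>lebesgue)
      = (\<integral>\<^sup>+t\<in>{0..1/2}. ennreal \<bar>p' t\<bar> \<partial>lebesgue)"
  proof -
    have m: "(\<lambda>t. ennreal \<bar>p' t\<bar> * indicator {u..v} t) \<in> borel_measurable lebesgue"
      if "u \<le> v" "0 \<le> u" "v \<le> 1/2" for u v
    proof -
      have "(\<lambda>t. ennreal \<bar>indicator {u..v} t * p' t\<bar>) \<in> borel_measurable lebesgue"
        using derivative_measurable_on_interval[of u v p p'] dp that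
      by (intro measurable_compose[OF _ measurable_ennreal] borel_measurable_abs) auto
      then show ?thesis
        by (rule measurable_cong[THEN iffD1, rotated]) (auto simp: indicator_def)
    qed
    have "(\<integral>\<^sup>+t\<in>{0..s}. ennreal \<bar>p' t\<bar> \<partial>lebesgue) + (\<integral>\<^sup>+t\<in>{s..1/2}. ennreal \<bar>p' t\<bar> \<partial>lebesgue)
      = (\<integral>\<^sup>+t. ennreal \<bar>p' t\<bar> * indicator {0..s} t + ennreal \<bar>p' t\<bar> * indicator {s..1/2} t \<partial>lebesgue)"
      using s by (intro nn_integral_add[symmetric] m) auto
    also have "\<dots> = (\<integral>\<^sup>+t\<in>{0..1/2}. ennreal \<bar>p' t\<bar> \<partial>lebesgue)"
    proof (rule nn_integral_cong_AE)
      have "AE t in lebesgue. t \<noteq> s"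
        by (rule AE_completion) (rule AE_lborel_singleton)
      then show "AE t in lebesgue. ennreal \<bar>p' t\<bar> * indicator {0..s} t + ennreal \<bar>p' t\<bar> * indicator {s..1/2} t
          = ennreal \<bar>p' t\<bar> * indicator {0..1/2} t"
        by eventually_elim (use s in \<open>auto simp: indicator_def\<close>)
    qed
    finally show ?thesis .
  qed
  have "2 * \<bar>(p 0 + p 1) / 2 - p s\<bar> = \<bar>2 * ((p 0 + p 1) / 2 - p s)\<bar>"
    by (simp only: abs_mult abs_numeral)
  also have "2 * ((p 0 + p 1) / 2 - p s) = (p 0 - p s) + (p 1 - p s)"
    by (simp add: field_simps)
  also have "\<bar>(p 0 - p s) + (p 1 - p s)\<bar> \<le> \<bar>p s - p 0\<bar> + \<bar>p (1/2) - p s\<bar> + \<bar>q (1/2) - q 0\<bar>"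
    unfolding q_def by simp
  finally have "ennreal (2 * \<bar>(p 0 + p 1) / 2 - p s\<bar>)
      \<le> ennreal \<bar>p s - p 0\<bar> + ennreal \<bar>p (1/2) - p s\<bar> + ennreal \<bar>q (1/2) - q 0\<bar>"
    by (simp flip: ennreal_plus)
  also have "\<dots> \<le> (\<integral>\<^sup>+t\<in>{0..s}. ennreal \<bar>p' t\<bar> \<partial>lebesgue) + (\<integral>\<^sup>+t\<in>{s..1/2}. ennreal \<bar>p' t\<bar> \<partial>lebesgue)
      + (\<integral>\<^sup>+t\<in>{0..1/2}. ennreal \<bar>- p' (1 - t)\<bar> \<partial>lebesgue)"
    using s by (intro add_mono increment_le_nn_integral_derivative dp dq) auto
  also have "\<dots> = (\<integral>\<^sup>+t\<in>{0..1/2}. ennreal \<bar>p' t\<bar> \<partial>lebesgue)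
      + (\<integral>\<^sup>+t\<in>{0..1/2}. ennreal \<bar>- p' (1 - t)\<bar> \<partial>lebesgue)"
    by (simp only: split_at_s)
  also have "\<dots> = (\<integral>\<^sup>+t. ennreal \<bar>indicator {0..1/2} t * p' t\<bar> \<partial>lebesgue)
      + (\<integral>\<^sup>+t. ennreal \<bar>indicator {0..1/2} t * - p' (1 - t)\<bar> \<partial>lebesgue)"
    by (intro arg_cong2[where f="(+)"] nn_integral_cong) (auto simp: indicator_def)
  also have "\<dots> = (\<integral>\<^sup>+t. ennreal \<bar>indicator {0..1/2} t * p' t\<bar>
      + ennreal \<bar>indicator {0..1/2} t * - p' (1 - t)\<bar> \<partial>lebesgue)"
    using derivative_measurable_on_interval[of 0 "1/2" p p'] dp
      derivative_measurable_on_interval[of 0 "1/2" q "\<lambda>t. - p' (1 - t)"] dq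
    by (intro nn_integral_add[symmetric] measurable_compose[OF _ measurable_ennreal]
        borel_measurable_abs) auto
  also have "\<dots> = (\<integral>\<^sup>+t\<in>{0..1/2}. ennreal (\<bar>p' t\<bar> + \<bar>p' (1 - t)\<bar>) \<partial>lebesgue)"
    by (intro nn_integral_cong) (auto simp: indicator_def ennreal_plus)
  finally show ?thesis .
qed

text \<open>
  Both sides are unchanged when p and s are replaced by the reflected function p(1 - t) and 1 - s, which
  moves a point of the right half to the left half.
\<close>
lemma endpoint_average_deviation:
  fixes p p' :: "real \<Rightarrow> real"
  assumes der: "\<And>t. t \<in> {0..1} \<Longrightarrow> (p has_real_derivative p' t) (at t within {0..1})"
    and s: "s \<in> {0..1}"
  shows "ennreal (2 * \<bar>(p 0 + p 1) / 2 - p s\<bar>)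
           \<le> (\<integral>\<^sup>+t\<in>{0..1/2}. ennreal (\<bar>p' t\<bar> + \<bar>p' (1 - t)\<bar>) \<partial>lebesgue)"
proof (cases "s \<le> 1/2")
  case True
  with assms show ?thesis
    by (intro endpoint_average_deviation_left_half) auto
next
  case False
  have "((\<lambda>t. p (1 - t)) has_real_derivative - p' (1 - t)) (at t within {0..1})"
    if "t \<in> {0..1}" for t
    using has_derivative_reflected[OF der that] by simp
  from endpoint_average_deviation_left_half[OF this, of "1 - s"] show ?thesis
    using False s by (simp add: add.commute)
qed

section \<open>Averages against the density\<close>

lemma deviation_of_average_le:
  fixes f g :: "real \<Rightarrow> real"
  assumes cont: "continuous_on {a..b} f" "continuous_on {a..b} g"
    and g_nonneg: "\<forall>x\<in>{a..b}. 0 \<le> g x"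
    and mass: "(LINT x:{a..b}|lebesgue. g x) = 1"
    and bound: "\<And>x. x \<in> {a..b} \<Longrightarrow> \<bar>K - f x\<bar> \<le> B"
  shows "\<bar>K - (LINT x:{a..b}|lebesgue. f x * g x)\<bar> \<le> B"
proof -
  have int_g: "set_integrable lebesgue {a..b} g"
    using absolutely_integrable_continuous_real[OF cont(2)] .
  then have int_Kg: "set_integrable lebesgue {a..b} (\<lambda>x. K * g x)"
    by (rule set_integrable_mult_right)
  have int_fg: "set_integrable lebesgue {a..b} (\<lambda>x. f x * g x)"
    by (intro absolutely_integrable_continuous_real continuous_intros cont)
  have "K - (LINT x:{a..b}|lebesgue. f x * g x)
      = (LINT x:{a..b}|lebesgue. K * g x) - (LINT x:{a..b}|lebesgue. f x * g x)"
    by (simp add: mass)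
  also have "\<dots> = (LINT x:{a..b}|lebesgue. K * g x - f x * g x)"
    by (intro set_integral_diff(2)[symmetric] int_Kg int_fg)
  also have "\<bar>LINT x:{a..b}|lebesgue. K * g x - f x * g x\<bar> \<le> (LINT x:{a..b}|lebesgue. B * g x)"
    unfolding set_lebesgue_integral_def real_norm_def[symmetric]
  proof (rule Bochner_Integration.integral_norm_bound_integral)
    show "integrable lebesgue (\<lambda>x. indicat_real {a..b} x *\<^sub>R (K * g x - f x * g x))"
      using set_integral_diff(1)[OF int_Kg int_fg] unfolding set_integrable_def .
    show "integrable lebesgue (\<lambda>x. indicat_real {a..b} x *\<^sub>R (B * g x))"
      using int_g by (simp add: set_integrable_def mult.left_commute)
    show "norm (indicat_real {a..b} x *\<^sub>R (K * g x - f x * g x)) \<le> indicat_real {a..b} x *\<^sub>R (B * g x)" for x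
      using g_nonneg bound[of x]
      by (auto simp: indicator_def abs_mult left_diff_distrib[symmetric] intro!: mult_right_mono)
  qed
  also have "\<dots> = B"
    by (simp add: mass)
  finally show ?thesis .
qed

text \<open>
  The reflection at the midpoint carries the integral over the left half to that over the right half.
\<close>
lemma half_mass_of_symmetric:
  fixes g :: "real \<Rightarrow> real"
  assumes "a \<le> b" and cont: "continuous_on {a..b} g"
    and g_nonneg: "\<forall>x\<in>{a..b}. 0 \<le> g x"
    and mass: "(LINT x:{a..b}|lebesgue. g x) = M"
    and sym: "symmetric_to_midpoint a b g"
  shows "(\<integral>\<^sup>+x\<in>{a..(a + b) / 2}. ennreal (g x) \<partial>lebesgue) = ennreal (M / 2)"
proof -
  let ?m = "(a + b) / 2"
  have am: "{a..?m} \<subseteq> {a..b}" "a \<le> ?m" "?m \<le> b"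
    using \<open>a \<le> b\<close> by auto
  define J where "J = integral {a..?m} g"
  have J: "(g has_integral J) {a..?m}"
    unfolding J_def
    by (intro integrable_integral integrable_continuous_real continuous_on_subset[OF cont] am)
  have "((\<lambda>x. g (a + b - x)) has_integral J) ((\<lambda>x. a + b - x) ` {a..?m})"
    using has_integral_affinity[of g J a ?m "-1" "a + b"] J by (simp add: add.commute)
  also have "(\<lambda>x. a + b - x) ` {a..?m} = {a + b - ?m..b}"
    by simp
  also have "a + b - ?m = ?m"
    by (simp add: field_simps)
  finally have "((\<lambda>x. g (a + b - x)) has_integral J) {?m..b}" .
  moreover have "g (a + b - x) = g x" if "x \<in> {?m..b}" for x
  proof -
    have "x \<in> {a..b}"
      using that am by auto
    with sym show ?thesis
      unfolding symmetric_to_midpoint_def by metis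
  qed
  ultimately have "(g has_integral J) {?m..b}"
    using has_integral_cong[of "{?m..b}" "\<lambda>x. g (a + b - x)" g J] by blast
  with J have "(g has_integral (J + J)) {a..b}"
    by (intro has_integral_combine[OF am(2,3)])
  moreover have "(g has_integral M) {a..b}"
    using absolutely_integrable_continuous_real[OF cont] mass
    by (metis has_integral_integral set_lebesgue_integral_eq_integral)
  ultimately have "J + J = M"
    by (rule has_integral_unique)
  then have "J = M / 2"
    by simp
  have "(\<integral>\<^sup>+x\<in>{a..?m}. ennreal (g x) \<partial>lebesgue) = ennreal J"
    unfolding nn_integral_completion
    by (rule nn_integral_has_integral_lebesgue'[OF _ J]) (use g_nonneg am(1) in blast)
  then show ?thesis
    unfolding \<open>J = M / 2\<close> .
qed

section \<open>The weighted trapezoid inequality\<close>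

theorem mainTheorem7:
  fixes I :: "real set" and a b l :: real and f g h :: "real \<Rightarrow> real"
  assumes "is_interval I"
    and "a \<in> interior I" and "b \<in> interior I" and "0 < a" and "a < b"
    and "f differentiable_on interior I"
    and "continuous_on {a..b} g"
    and "\<forall>x\<in>{a..b}. 0 \<le> g x"
    and "(LINT x:{a..b}|lebesgue. g x) = 1"
    and "symmetric_to_midpoint a b g"
    and "moment a b g l < \<infinity>"
    and "\<forall>t\<in>{0..1}. 0 \<le> h t"
    and "\<exists>t\<in>{0..1}. h t \<noteq> 0"
    and "h_convex_on h {a..b} (\<lambda>x. \<bar>deriv f x\<bar>)"
  shows "ennreal \<bar>(f a + f b) / 2 * (LINT x:{a..b}|lebesgue. g x)
                    - (LINT x:{a..b}|lebesgue. f x * g x)\<bar>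
           \<le> ennreal ((b - a) * (\<bar>deriv f a\<bar> + \<bar>deriv f b\<bar>)) *
             (\<integral>\<^sup>+x\<in>{a..(a + b) / 2}.
                (\<integral>\<^sup>+t\<in>{0..1/2}. ennreal (g x * (h t + h (1 - t))) \<partial>lebesgue) \<partial>lebesgue)
         \<and> ennreal ((b - a) * (\<bar>deriv f a\<bar> + \<bar>deriv f b\<bar>)) *
             (\<integral>\<^sup>+x\<in>{a..(a + b) / 2}.
                (\<integral>\<^sup>+t\<in>{0..1/2}. ennreal (g x * (h t + h (1 - t))) \<partial>lebesgue) \<partial>lebesgue)
           = ennreal ((b - a) / 2 * (\<bar>deriv f a\<bar> + \<bar>deriv f b\<bar>)) *
             (\<integral>\<^sup>+t\<in>{0..1/2}. ennreal (h t + h (1 - t)) \<partial>lebesgue)"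
proof -
  let ?K = "(f a + f b) / 2"
  let ?c = "\<bar>deriv f a\<bar> + \<bar>deriv f b\<bar>"
  let ?H = "\<integral>\<^sup>+t\<in>{0..1/2}. ennreal (h t + h (1 - t)) \<partial>lebesgue"
  let ?R = "ennreal ((b - a) / 2 * ?c) * ?H"
  note g_nonneg = assms(8) and h_nonneg = assms(12)
  have "convex (interior I)"
    using \<open>is_interval I\<close> by (simp add: is_interval_convex convex_interior)
  then have sub: "{a..b} \<subseteq> interior I"
    using \<open>a \<in> interior I\<close> \<open>b \<in> interior I\<close> \<open>a < b\<close>
    by (metis closed_segment_eq_real_ivl closed_segment_subset less_imp_le)
  have der_f: "(f has_real_derivative deriv f x) (at x)" if "x \<in> {a..b}" for x
    using \<open>f differentiable_on interior I\<close> sub that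
    by (metis DERIV_deriv_iff_real_differentiable at_within_interior differentiable_on_def
        interior_interior subsetD)
  have cont_f: "continuous_on {a..b} f"
    using der_f by (meson DERIV_continuous continuous_at_imp_continuous_on)

  define p where "p t = f ((1 - t) * a + t * b)" for t
  define p' where "p' t = (b - a) * deriv f ((1 - t) * a + t * b)" for t
  have mem: "(1 - t) * a + t * b \<in> {a..b}" if "t \<in> {0..1}" for t
    using convexD_alt[OF convex_real_interval(5)[of a b], of a b t] that \<open>a < b\<close> by simp
  have der_p: "(p has_real_derivative p' t) (at t within {0..1})" if "t \<in> {0..1}" for t
    unfolding p_def p'_def
    by (rule DERIV_chain'[where f = "\<lambda>t. (1 - t) * a + t * b" and g = f,
          THEN DERIV_cong, OF _ der_f[OF mem[OF that]]])
      (auto intro!: derivative_eq_intros)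

  have p'_bound: "\<bar>p' t\<bar> + \<bar>p' (1 - t)\<bar> \<le> (b - a) * ?c * (h t + h (1 - t))" if "t \<in> {0..1}" for t
  proof -
    have conv: "\<bar>deriv f (l * a + (1 - l) * b)\<bar> \<le> h l * \<bar>deriv f a\<bar> + h (1 - l) * \<bar>deriv f b\<bar>"
      if "l \<in> {0..1}" for l
      using assms(14) that \<open>a < b\<close> unfolding h_convex_on_def by simp
    have "\<bar>p' t\<bar> + \<bar>p' (1 - t)\<bar>
        = (b - a) * (\<bar>deriv f ((1 - t) * a + t * b)\<bar> + \<bar>deriv f (t * a + (1 - t) * b)\<bar>)"
      using \<open>a < b\<close> by (simp add: p'_def abs_mult distrib_left)
    also have "\<dots> \<le> (b - a) * (?c * (h t + h (1 - t)))"
      using conv[of t] conv[of "1 - t"] that \<open>a < b\<close>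
      by (intro mult_left_mono) (simp_all add: algebra_simps)
    finally show ?thesis by (simp add: mult.assoc)
  qed
  have int_bound: "(\<integral>\<^sup>+t\<in>{0..1/2}. ennreal (\<bar>p' t\<bar> + \<bar>p' (1 - t)\<bar>) \<partial>lebesgue)
      \<le> ennreal ((b - a) * ?c) * ?H"
  proof -
    have "ennreal (\<bar>p' t\<bar> + \<bar>p' (1 - t)\<bar>) \<le> ennreal ((b - a) * ?c) * ennreal (h t + h (1 - t))"
      if "t \<in> {0..1/2}" for t
      using p'_bound[of t] that \<open>a < b\<close> h_nonneg
      by (subst ennreal_mult[symmetric]) (auto simp del: ennreal_plus intro!: ennreal_leI)
    then have "(\<integral>\<^sup>+t\<in>{0..1/2}. ennreal (\<bar>p' t\<bar> + \<bar>p' (1 - t)\<bar>) \<partial>lebesgue)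
        \<le> (\<integral>\<^sup>+t. ennreal ((b - a) * ?c) * (ennreal (h t + h (1 - t)) * indicator {0..1/2} t) \<partial>lebesgue)"
      by (intro nn_integral_mono) (simp add: indicator_def del: ennreal_plus)
    then show ?thesis by (simp add: nn_integral_cmult_nonmeasurable)
  qed

  have half_R: "ennreal (1/2) * (ennreal ((b - a) * ?c) * ?H) = ?R"
    unfolding mult.assoc[symmetric] using \<open>a < b\<close> by (subst ennreal_mult[symmetric]) auto

  have pointwise: "ennreal \<bar>?K - f x\<bar> \<le> ?R" if x: "x \<in> {a..b}" for x
  proof -
    define s where "s = (x - a) / (b - a)"
    have s: "s \<in> {0..1}"
      using x \<open>a < b\<close> by (auto simp: s_def field_simps)
    have "s * (b - a) = x - a"
      using \<open>a < b\<close> by (simp add: s_def)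
    then have "(1 - s) * a + s * b = x"
      by (simp add: algebra_simps)
    then have "p 0 = f a" "p 1 = f b" "p s = f x"
      by (simp_all add: p_def)
    then have "ennreal (2 * \<bar>?K - f x\<bar>) \<le> ennreal ((b - a) * ?c) * ?H"
      using order_trans[OF endpoint_average_deviation[OF der_p s] int_bound] by simp
    then have "ennreal (1/2) * ennreal (2 * \<bar>?K - f x\<bar>)
        \<le> ennreal (1/2) * (ennreal ((b - a) * ?c) * ?H)"
      by (intro mult_left_mono) auto
    moreover have "ennreal (1/2) * ennreal (2 * \<bar>?K - f x\<bar>) = ennreal \<bar>?K - f x\<bar>"
      by (subst ennreal_mult[symmetric]) auto
    ultimately show ?thesis
      using half_R by (simp only:)
  qed

  have estimate: "ennreal \<bar>?K * (LINT x:{a..b}|lebesgue. g x) - (LINT x:{a..b}|lebesgue. f x * g x)\<bar> \<le> ?R"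
  proof (cases ?R)
    case (real r)
    have "\<bar>?K - f x\<bar> \<le> r" if "x \<in> {a..b}" for x
      using pointwise[OF that] \<open>0 \<le> r\<close> unfolding real(2) by (simp only: ennreal_le_iff)
    then have "\<bar>?K - (LINT x:{a..b}|lebesgue. f x * g x)\<bar> \<le> r"
      by (rule deviation_of_average_le[OF cont_f assms(7-9)])
    then show ?thesis
      unfolding real(2) assms(9) mult_1_right by (rule ennreal_leI)
  next
    case top
    then show ?thesis by (simp only: top_greatest)
  qed

  have product: "(\<integral>\<^sup>+x\<in>{a..(a + b) / 2}.
        (\<integral>\<^sup>+t\<in>{0..1/2}. ennreal (g x * (h t + h (1 - t))) \<partial>lebesgue) \<partial>lebesgue) = ennreal (1/2) * ?H"
  proof -
    have inner: "(\<integral>\<^sup>+t\<in>{0..1/2}. ennreal (g x * (h t + h (1 - t))) \<partial>lebesgue) = ennreal (g x) * ?H"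
      if "x \<in> {a..(a + b) / 2}" for x
    proof -
      have "0 \<le> g x"
        using g_nonneg that \<open>a < b\<close> by auto
      then have "(\<integral>\<^sup>+t\<in>{0..1/2}. ennreal (g x * (h t + h (1 - t))) \<partial>lebesgue)
          = (\<integral>\<^sup>+t. ennreal (g x) * (ennreal (h t + h (1 - t)) * indicator {0..1/2} t) \<partial>lebesgue)"
        using h_nonneg by (intro nn_integral_cong) (auto simp: indicator_def ennreal_mult)
      then show ?thesis by (simp add: nn_integral_cmult_nonmeasurable)
    qed
    have "(\<lambda>x. ennreal (indicator {a..(a + b) / 2} x * g x)) \<in> borel_measurable lebesgue"
    proof -
      have "set_integrable lebesgue {a..(a + b) / 2} g"
        using \<open>a < b\<close> by (intro absolutely_integrable_continuous_real continuous_on_subset[OF assms(7)]) auto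
      then show ?thesis
        by (auto simp: set_integrable_def dest: borel_measurable_integrable)
    qed
    then have meas: "(\<lambda>x. ennreal (g x) * indicator {a..(a + b) / 2} x) \<in> borel_measurable lebesgue"
      by (rule measurable_cong[THEN iffD1, rotated]) (auto simp: indicator_def)
    have "(\<integral>\<^sup>+x\<in>{a..(a + b) / 2}.
        (\<integral>\<^sup>+t\<in>{0..1/2}. ennreal (g x * (h t + h (1 - t))) \<partial>lebesgue) \<partial>lebesgue)
        = (\<integral>\<^sup>+x. (ennreal (g x) * indicator {a..(a + b) / 2} x) * ?H \<partial>lebesgue)"
    proof (rule nn_integral_cong)
      fix x
      show "(\<integral>\<^sup>+t\<in>{0..1/2}. ennreal (g x * (h t + h (1 - t))) \<partial>lebesgue) * indicator {a..(a + b) / 2} x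
          = ennreal (g x) * indicator {a..(a + b) / 2} x * ?H"
        using inner[of x]
        by (cases "x \<in> {a..(a + b) / 2}")
          (simp_all only: indicator_simps not_False_eq_True mult_1_right mult_zero_left mult_zero_right)
    qed
    also have "\<dots> = (\<integral>\<^sup>+x\<in>{a..(a + b) / 2}. ennreal (g x) \<partial>lebesgue) * ?H"
      by (rule nn_integral_multc[OF meas])
    also have "(\<integral>\<^sup>+x\<in>{a..(a + b) / 2}. ennreal (g x) \<partial>lebesgue) = ennreal (1/2)"
      using half_mass_of_symmetric[OF _ assms(7-10)] \<open>a < b\<close> by simp
    finally show ?thesis .
  qed
  have "ennreal ((b - a) * ?c) * (ennreal (1/2) * ?H) = ?R"
    using half_R by (simp only: mult.left_commute)
  with estimate show ?thesis
    unfolding product by (simp only: order_refl simp_thms)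
qed

end
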